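(* Let $A\in\mathbb{R}^{n\times n}$ be a monotone matrix and let $A=K-L=U-V=X-Y$ be three weak regular splittings of type II of $A$. Let $\mathcal{H}=X^{-1}YU^{-1}VK^{-1}L$ and $\mathcal{S}=YX^{-1}VU^{-1}LK^{-1}$. Let $A=B-C$, $A=B_{12}-C_{12}$, $A=B_{13}-C_{13}$ and $A=B_{23}-C_{23}$ be weak regular splittings of type II induced by the matrices $\mathcal{S}$, $U^{-1}VK^{-1}L$, $X^{-1}YK^{-1}L$ and $X^{-1}YU^{-1}V$, respectively. If $B_{12}B^{-1}\ge I$, $B_{13}B^{-1}\ge I$ and $B_{23}B^{-1}\ge I$, then $$\rho(\mathcal{H})\le\min\{\rho(K^{-1}LU^{-1}V),\rho(X^{-1}YK^{-1}L),\rho(X^{-1}YU^{-1}V)\}<1.$$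
   Context: All matrices are real $n\times n$; $\rho$ is the spectral radius; inequalities between matrices are entrywise. $A$ is monotone if $Ax\ge 0\Rightarrow x\ge 0$; equivalently $A^{-1}$ exists and $A^{-1}\ge 0$. A splitting $A=U-V$ is an expression with $U$ nonsingular; it is weak regular of type II if $U^{-1}\ge 0$ and $VU^{-1}\ge 0$. The splitting $A=B-C$ induced by $\mathcal{S}$ is the one with $CB^{-1}=\mathcal{S}$, i.e. $B=(I-\mathcal{S})^{-1}A$. A splitting $A=B'-C'$ is induced by an iteration matrix $T$ (such as $U^{-1}VK^{-1}L$) if $(B')^{-1}C'=T$, i.e. $B'=A(I-T)^{-1}$. *)

theory Defs
  imports "Jordan_Normal_Form.Spectral_Radius" "Jordan_Normal_Form.Gauss_Jordan_Elimination"
begin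

text \<open>The order \<open>\<le>\<close> on \<^typ>\<open>real mat\<close> and \<^typ>\<open>real vec\<close> is the entrywise order (equal dimensions
  included).\<close>

text \<open>The library inverse is option-valued; the total version is only meaningful on
  invertible matrices.\<close>

definition mat_inv :: "real mat \<Rightarrow> real mat" where
  "mat_inv M = the (mat_inverse M)"

lemma mat_inv:
  assumes M: "M \<in> carrier_mat n n" and inv: "invertible_mat M"
  shows "mat_inv M \<in> carrier_mat n n" "M * mat_inv M = 1\<^sub>m n" "mat_inv M * M = 1\<^sub>m n"
proof -
  obtain N where MN: "M * N = 1\<^sub>m n" and NM: "N * M = 1\<^sub>m (dim_row N)"
    using inv M unfolding invertible_mat_def inverts_mat_def by auto
  have N: "N \<in> carrier_mat n n"
    using arg_cong[OF MN, of dim_col] arg_cong[OF NM, of dim_col] M by auto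
  then have "M \<in> Units (ring_mat TYPE(real) n ())"
    using M MN NM unfolding Units_def ring_mat_def by auto
  then obtain P where "mat_inverse M = Some P"
    using mat_inverse(1)[OF M] by fastforce
  then show "mat_inv M \<in> carrier_mat n n" "M * mat_inv M = 1\<^sub>m n" "mat_inv M * M = 1\<^sub>m n"
    using mat_inverse(2)[OF M] unfolding mat_inv_def by auto
qed

text \<open>Spectral radius of a real matrix, over its complex eigenvalues.\<close>

definition rho :: "real mat \<Rightarrow> real" where
  "rho M = spectral_radius (map_mat complex_of_real M)"

definition monotone_mat :: "nat \<Rightarrow> real mat \<Rightarrow> bool" where
  "monotone_mat n A \<longleftrightarrow> A \<in> carrier_mat n n \<and>
     (\<forall>x \<in> carrier_vec n. 0\<^sub>v n \<le> A *\<^sub>v x \<longrightarrow> 0\<^sub>v n \<le> x)"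

definition splitting :: "nat \<Rightarrow> real mat \<Rightarrow> real mat \<Rightarrow> real mat \<Rightarrow> bool" where
  "splitting n A U V \<longleftrightarrow> A \<in> carrier_mat n n \<and> U \<in> carrier_mat n n \<and> V \<in> carrier_mat n n \<and>
     A = U - V \<and> invertible_mat U"

definition weak_regular_type_II :: "nat \<Rightarrow> real mat \<Rightarrow> real mat \<Rightarrow> real mat \<Rightarrow> bool" where
  "weak_regular_type_II n A U V \<longleftrightarrow> splitting n A U V \<and>
     0\<^sub>m n n \<le> mat_inv U \<and> 0\<^sub>m n n \<le> V * mat_inv U"

text \<open>A matrix can induce a splitting \<open>B - C\<close> in two ways: as \<open>C B\<^sup>-\<^sup>1\<close>, or as the iteration
  matrix \<open>B\<^sup>-\<^sup>1 C\<close>.\<close>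

definition induced_right :: "nat \<Rightarrow> real mat \<Rightarrow> real mat \<Rightarrow> real mat \<Rightarrow> real mat \<Rightarrow> bool" where
  "induced_right n A B C S \<longleftrightarrow> splitting n A B C \<and> C * mat_inv B = S"

definition induced_iteration :: "nat \<Rightarrow> real mat \<Rightarrow> real mat \<Rightarrow> real mat \<Rightarrow> real mat \<Rightarrow> bool" where
  "induced_iteration n A B C T \<longleftrightarrow> splitting n A B C \<and> mat_inv B * C = T"

end

theory Submission
  imports Defs
begin

text \<open>For a splitting \<open>A = U - V\<close> one has \<open>A (U\<^sup>-\<^sup>1 V) = (V U\<^sup>-\<^sup>1) A\<close>, so \<open>H\<close> is similar to the
  nonnegative matrix \<open>S = C B\<^sup>-\<^sup>1\<close>, and each two-factor product has the spectral radius of the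
  nonnegative matrix \<open>Q = C' B'\<^sup>-\<^sup>1\<close> of its induced splitting \<open>A = B' - C'\<close>.
  The Perron--Frobenius theorem is avoided by testing with positive left vectors:
  \<open>y\<^sup>T P \<le> r y\<^sup>T\<close> forces \<open>\<rho>(P) \<le> r\<close> for \<open>P \<ge> 0\<close>, and for every \<open>r > \<rho>(P)\<close> a partial sum of the Neumann
  series provides such a \<open>y\<close>. The column sums \<open>y\<close> of \<open>A\<^sup>-\<^sup>1\<close> satisfy \<open>y\<^sup>T (I - Q) = 1\<^sup>T B'\<^sup>-\<^sup>1 > 0\<close>, whence
  \<open>\<rho>(Q) < 1\<close>. Finally \<open>I - S = (I - Q) (B' B\<^sup>-\<^sup>1)\<close> with \<open>B' B\<^sup>-\<^sup>1 \<ge> I\<close>, so for \<open>\<rho>(Q) < r < 1\<close>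
  a vector with \<open>y\<^sup>T Q \<le> r y\<^sup>T\<close> has \<open>y\<^sup>T (I - S) \<ge> y\<^sup>T (I - Q)\<close>, that is, \<open>y\<^sup>T S \<le> r y\<^sup>T\<close>.\<close>

section \<open>Entrywise nonnegative matrices\<close>

lemma nonneg_matD: "0\<^sub>m n m \<le> M \<Longrightarrow> i < n \<Longrightarrow> j < m \<Longrightarrow> 0 \<le> M $$ (i, j)"
  for M :: "real mat"
  by (auto simp: less_eq_mat_def)

lemma nonneg_mult_mat:
  fixes M N :: "real mat"
  assumes "0\<^sub>m n k \<le> M" and "0\<^sub>m k m \<le> N"
  shows "0\<^sub>m n m \<le> M * N"
  using assms by (auto simp: less_eq_mat_def scalar_prod_def intro!: sum_nonneg)

lemma nonneg_pow_mat:
  fixes M :: "real mat"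
  assumes "M \<in> carrier_mat n n" and "0\<^sub>m n n \<le> M"
  shows "0\<^sub>m n n \<le> M ^\<^sub>m k"
proof (induction k)
  case 0
  show ?case using assms by (auto simp: less_eq_mat_def)
next
  case (Suc k)
  then show ?case using nonneg_mult_mat[OF Suc assms(2)] by simp
qed

section \<open>Spectral radius: eigenvalue bounds, products and scaling\<close>

lemma rho_ge:
  assumes "M \<in> carrier_mat n n" and "n > 0" and "eigenvalue (map_mat complex_of_real M) e"
  shows "norm e \<le> rho M"
  unfolding rho_def using assms
  by (intro spectral_radius_mem_max(2)[of _ n]) (auto simp: spectrum_def)

lemma rho_attained:
  assumes M: "M \<in> carrier_mat n n" and n: "n > 0"
  obtains e v where "norm e = rho M" "v \<in> carrier_vec n" "v \<noteq> 0\<^sub>v n"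
    "map_mat complex_of_real M *\<^sub>v v = e \<cdot>\<^sub>v v"
proof -
  have "rho M \<in> norm ` spectrum (map_mat complex_of_real M)"
    unfolding rho_def using M n by (intro spectral_radius_mem_max(1)[of _ n]) auto
  then show ?thesis
    using that M by (auto simp: spectrum_def eigenvalue_def eigenvector_def)
qed

lemma rho_nonneg:
  assumes "M \<in> carrier_mat n n" and "n > 0"
  shows "0 \<le> rho M"
  using rho_attained[OF assms] by (metis norm_ge_zero)

text \<open>If \<open>M N v = e v\<close> with \<open>e\<close> nonzero, then \<open>w = N v\<close>
  is an eigenvector of \<open>N M\<close> for the same \<open>e\<close>; it cannot vanish because
  \<open>M w = e v\<close> does not.\<close>

lemma rho_mult_commute_le:
  assumes M: "M \<in> carrier_mat n n" and N: "N \<in> carrier_mat n n" and n: "n > 0"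
  shows "rho (M * N) \<le> rho (N * M)"
proof -
  let ?c = "map_mat complex_of_real"
  have MN: "M * N \<in> carrier_mat n n" and NM: "N * M \<in> carrier_mat n n" using M N by auto
  have cM: "?c M \<in> carrier_mat n n" and cN: "?c N \<in> carrier_mat n n" using M N by auto
  obtain e v where e: "norm e = rho (M * N)" and v: "v \<in> carrier_vec n" "v \<noteq> 0\<^sub>v n"
    and ev: "?c (M * N) *\<^sub>v v = e \<cdot>\<^sub>v v"
    by (rule rho_attained[OF MN n])
  show ?thesis
  \<comment> \<open>For \<open>e = 0\<close> the vector \<open>N v\<close> may vanish, but then the
    left side is 0 and nonnegativity of \<open>rho\<close> suffices.\<close>
  proof (cases "e = 0")
    case True
    then show ?thesis using e rho_nonneg[OF NM n] by simp
  next
    case False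
    define w where "w = ?c N *\<^sub>v v"
    have w: "w \<in> carrier_vec n" unfolding w_def by (rule mult_mat_vec_carrier[OF cN v(1)])
    have Mw: "?c M *\<^sub>v w = e \<cdot>\<^sub>v v"
      using ev v cM cN M N by (simp add: w_def of_real_hom.mat_hom_mult[OF M N])
    have w0: "w \<noteq> 0\<^sub>v n"
    proof
      assume "w = 0\<^sub>v n"
      then have "e \<cdot>\<^sub>v v = ?c M *\<^sub>v 0\<^sub>v n" using Mw by simp
      also have "\<dots> = 0\<^sub>v n" by (rule eq_vecI) (use cM in auto)
      finally have "v = 0\<^sub>v n"
        using False v(1) by (auto simp: vec_eq_iff)
      then show False using v by simp
    qed
    have "?c (N * M) *\<^sub>v w = ?c N *\<^sub>v (?c M *\<^sub>v w)"
      using w cM cN by (simp add: of_real_hom.mat_hom_mult[OF N M])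
    also have "\<dots> = e \<cdot>\<^sub>v w" 
      unfolding Mw using v cN by (simp add: w_def mult_mat_vec[of _ n n])
    finally have "eigenvalue (?c (N * M)) e"
      using w w0 N M unfolding eigenvalue_def eigenvector_def by auto
    from rho_ge[OF NM n this] show ?thesis using e by simp
  qed
qed

lemma rho_mult_commute:
  assumes "M \<in> carrier_mat n n" and "N \<in> carrier_mat n n" and "n > 0"
  shows "rho (M * N) = rho (N * M)"
  using assms by (intro antisym rho_mult_commute_le)

text \<open>Dividing an eigenvalue of the scaled matrix by \<open>c\<close> gives one of
  \<open>M\<close>. Applied with \<open>c\<close> a reciprocal, to rescale a matrix to spectral
  radius below 1.\<close>

lemma rho_smult_le:
  assumes M: "M \<in> carrier_mat n n" and n: "n > 0" and c: "c > 0"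
  shows "rho (c \<cdot>\<^sub>m M) \<le> c * rho M"
proof -
  let ?c = "map_mat complex_of_real"
  have cM: "c \<cdot>\<^sub>m M \<in> carrier_mat n n" using M by auto
  obtain e v where e: "norm e = rho (c \<cdot>\<^sub>m M)" and v: "v \<in> carrier_vec n" "v \<noteq> 0\<^sub>v n"
    and ev: "?c (c \<cdot>\<^sub>m M) *\<^sub>v v = e \<cdot>\<^sub>v v"
    by (rule rho_attained[OF cM n])
  have "?c M *\<^sub>v v = (e / c) \<cdot>\<^sub>v v"
  proof (rule eq_vecI)
    fix i assume i: "i < dim_vec ((e / c) \<cdot>\<^sub>v v)"
    then have "(?c (c \<cdot>\<^sub>m M) *\<^sub>v v) $ i = (e \<cdot>\<^sub>v v) $ i" using ev by simp
    then have "c * (?c M *\<^sub>v v) $ i = e * v $ i"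
      using i v M by (simp add: scalar_prod_def sum_distrib_left mult.assoc)
    then show "(?c M *\<^sub>v v) $ i = ((e / c) \<cdot>\<^sub>v v) $ i"
      using i c by (simp add: field_simps)
  qed (use M v in auto)
  then have "eigenvalue (?c M) (e / c)"
    using v M unfolding eigenvalue_def eigenvector_def by auto
  from rho_ge[OF M n this] show ?thesis
    using c by (simp add: norm_divide e field_simps)
qed

section \<open>Bounding the spectral radius of a nonnegative matrix by positive test vectors\<close>

lemma nonneg_rho_subeigenvector:
  assumes P: "P \<in> carrier_mat n n" and n: "n > 0" and P0: "0\<^sub>m n n \<le> P"
  obtains w where "w \<in> carrier_vec n" "0\<^sub>v n \<le> w" "w \<noteq> 0\<^sub>v n" "rho P \<cdot>\<^sub>v w \<le> P *\<^sub>v w"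
proof -
  let ?c = "map_mat complex_of_real"
  obtain e v where e: "norm e = rho P" and v: "v \<in> carrier_vec n" "v \<noteq> 0\<^sub>v n"
    and ev: "?c P *\<^sub>v v = e \<cdot>\<^sub>v v"
    by (rule rho_attained[OF P n])
  \<comment> \<open>The moduli of a complex eigenvector replace the Perron vector: since
    \<open>P\<close> is nonnegative, the triangle inequality in each row of \<open>P v = e v\<close>
    gives the claim.\<close>
  define w where "w = map_vec norm v"
  have "rho P * norm (v $ i) \<le> (P *\<^sub>v w) $ i" if i: "i < n" for i
  proof -
    have "rho P * norm (v $ i) = norm ((?c P *\<^sub>v v) $ i)"
      unfolding ev using i v by (simp add: e norm_mult)
    also have "\<dots> = norm (\<Sum>j<n. of_real (P $$ (i, j)) * v $ j)"
      using i v P by (simp add: scalar_prod_def atLeast0LessThan)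
    also have "\<dots> \<le> (\<Sum>j<n. norm (of_real (P $$ (i, j)) * v $ j))" by (rule norm_sum)
    also have "\<dots> = (P *\<^sub>v w) $ i"
      using i v P nonneg_matD[OF P0]
      by (simp add: scalar_prod_def atLeast0LessThan w_def norm_mult)
    finally show ?thesis .
  qed
  then have "rho P \<cdot>\<^sub>v w \<le> P *\<^sub>v w"
    using v P by (auto simp: less_eq_vec_def w_def)
  moreover have "w \<noteq> 0\<^sub>v n" using v by (auto simp: vec_eq_iff w_def)
  moreover have "w \<in> carrier_vec n" "0\<^sub>v n \<le> w" using v by (auto simp: w_def less_eq_vec_def)
  ultimately show ?thesis using that by blast
qed

text \<open>Pairing \<open>y\<close> with the subeigenvector \<open>w\<close> and moving
  \<open>P\<close> to the other side by transposition. As \<open>y \<bullet> w\<close> is positive,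
  bounds on \<open>y^T P\<close> turn into bounds on \<open>rho P\<close> after cancelling
  it.\<close>

lemma rho_subinvariant_test_vector:
  assumes P: "P \<in> carrier_mat n n" and n: "n > 0" and P0: "0\<^sub>m n n \<le> P"
    and y: "y \<in> carrier_vec n" "\<And>j. j < n \<Longrightarrow> 0 < y $ j"
  obtains w where "w \<in> carrier_vec n" "0\<^sub>v n \<le> w" "0 < y \<bullet> w" "w \<noteq> 0\<^sub>v n"
    "rho P * (y \<bullet> w) \<le> (transpose_mat P *\<^sub>v y) \<bullet> w"
proof -
  obtain w where w: "w \<in> carrier_vec n" "0\<^sub>v n \<le> w" "w \<noteq> 0\<^sub>v n"
    and le: "rho P \<cdot>\<^sub>v w \<le> P *\<^sub>v w"
    by (rule nonneg_rho_subeigenvector[OF P n P0])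
  have "rho P * (y \<bullet> w) = y \<bullet> (rho P \<cdot>\<^sub>v w)" using y w by simp
  also have "\<dots> \<le> y \<bullet> (P *\<^sub>v w)"
    unfolding scalar_prod_def using le w y P
    by (auto simp: less_eq_vec_def intro!: sum_mono mult_left_mono intro: less_imp_le)
  also have "\<dots> = (transpose_mat P *\<^sub>v y) \<bullet> w"
    by (rule transpose_vec_mult_scalar[symmetric, OF P w(1) y(1)])
  finally have "rho P * (y \<bullet> w) \<le> (transpose_mat P *\<^sub>v y) \<bullet> w" .
  moreover obtain i where i: "i < n" "w $ i \<noteq> 0" using w by (auto simp: vec_eq_iff)
  have "0 < y \<bullet> w"
    unfolding scalar_prod_def
  proof (rule sum_pos2[of _ i])
    show "0 < y $ i * w $ i" using i w y by (auto simp: less_eq_vec_def order_less_le)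
  qed (use i w y in \<open>auto simp: less_eq_vec_def intro!: mult_nonneg_nonneg intro: less_imp_le\<close>)
  ultimately show ?thesis using that w by blast
qed

lemma rho_le_subinvariant:
  assumes P: "P \<in> carrier_mat n n" and n: "n > 0" and P0: "0\<^sub>m n n \<le> P"
    and y: "y \<in> carrier_vec n" "\<And>j. j < n \<Longrightarrow> 0 < y $ j"
    and le: "\<And>j. j < n \<Longrightarrow> (transpose_mat P *\<^sub>v y) $ j \<le> r * y $ j"
  shows "rho P \<le> r"
proof -
  obtain w where w: "w \<in> carrier_vec n" "0\<^sub>v n \<le> w" "0 < y \<bullet> w"
    and *: "rho P * (y \<bullet> w) \<le> (transpose_mat P *\<^sub>v y) \<bullet> w"
    by (rule rho_subinvariant_test_vector[OF P n P0 y])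
  note *
  also have "(transpose_mat P *\<^sub>v y) \<bullet> w \<le> r * (y \<bullet> w)"
    unfolding scalar_prod_def sum_distrib_left mult.assoc[symmetric] using w le
    by (intro sum_mono mult_right_mono) (auto simp: less_eq_vec_def)
  finally show ?thesis using w by simp
qed

text \<open>The vector \<open>w\<close> may have zero entries, so the pairing is strict because of a
  single index where \<open>w\<close> is nonzero, hence positive.\<close>

lemma rho_less_1_subinvariant:
  assumes P: "P \<in> carrier_mat n n" and n: "n > 0" and P0: "0\<^sub>m n n \<le> P"
    and y: "y \<in> carrier_vec n" "\<And>j. j < n \<Longrightarrow> 0 < y $ j"
    and less: "\<And>j. j < n \<Longrightarrow> (transpose_mat P *\<^sub>v y) $ j < y $ j"
  shows "rho P < 1"
proof -
  obtain w where w: "w \<in> carrier_vec n" "0\<^sub>v n \<le> w" "0 < y \<bullet> w" "w \<noteq> 0\<^sub>v n"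
    and *: "rho P * (y \<bullet> w) \<le> (transpose_mat P *\<^sub>v y) \<bullet> w"
    by (rule rho_subinvariant_test_vector[OF P n P0 y])
  obtain i where i: "i < n" "w $ i \<noteq> 0" using w by (auto simp: vec_eq_iff)
  note *
  also have "(transpose_mat P *\<^sub>v y) \<bullet> w < y \<bullet> w"
    unfolding scalar_prod_def
  proof (rule sum_strict_mono_ex1)
    show "\<exists>i\<in>{0..<dim_vec w}. (transpose_mat P *\<^sub>v y) $ i * w $ i < y $ i * w $ i"
      using i w less by (auto simp: less_eq_vec_def order_less_le intro!: bexI[of _ i])
  qed (use w less in \<open>auto simp: less_eq_vec_def intro!: mult_right_mono intro: less_imp_le\<close>)
  finally show ?thesis using w by simp
qed

section \<open>Decay of powers and partial sums of the Neumann series\<close>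

lemma pow_mat_smult:
  fixes M :: "'a :: comm_semiring_1 mat"
  assumes M: "M \<in> carrier_mat n n"
  shows "(c \<cdot>\<^sub>m M) ^\<^sub>m k = c ^ k \<cdot>\<^sub>m (M ^\<^sub>m k)"
proof (induction k)
  case 0
  show ?case by (auto intro!: eq_matI)
next
  case (Suc k)
  have Mk: "M ^\<^sub>m k \<in> carrier_mat n n" using M by simp
  show ?case
    using M Mk Suc by (auto intro!: eq_matI simp: scalar_prod_def sum_distrib_left mult_ac)
qed

text \<open>For \<open>rho M < t < 1\<close> the matrix \<open>M / t\<close> still has spectral
  radius below 1, so its powers are uniformly bounded and the entries of \<open>M^k\<close> are at
  most a constant times \<open>t^k\<close>.\<close>

lemma pow_mat_tendsto_0:
  assumes M: "M \<in> carrier_mat n n" and n: "n > 0" and rho: "rho M < 1"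
    and i: "i < n" and j: "j < n"
  shows "(\<lambda>k. (M ^\<^sub>m k) $$ (i, j)) \<longlonglongrightarrow> 0"
proof -
  let ?c = "map_mat complex_of_real"
  obtain t where t: "rho M < t" "t < 1" using dense rho by blast
  have t0: "t > 0" using rho_nonneg[OF M n] t by linarith
  define N where "N = (1 / t) \<cdot>\<^sub>m M"
  have N: "N \<in> carrier_mat n n" using M by (simp add: N_def)
  have "rho N \<le> 1 / t * rho M" unfolding N_def by (rule rho_smult_le[OF M n]) (use t0 in simp)
  also have "\<dots> < 1" using t t0 by simp
  finally have "spectral_radius (?c N) < 1" by (simp add: rho_def)
  then obtain b where b: "\<And>k. norm_bound (?c N ^\<^sub>m k) b"
    using spectral_radius_jnf_norm_bound_less_1_upper_triangular[of "?c N" n] N by auto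
  have bound: "norm ((M ^\<^sub>m k) $$ (i, j)) \<le> b * t ^ k" for k
  proof -
    have Nk: "N ^\<^sub>m k \<in> carrier_mat n n" using N by simp
    have "M = t \<cdot>\<^sub>m N" using t0 by (auto simp: N_def intro!: eq_matI)
    then have "(M ^\<^sub>m k) $$ (i, j) = t ^ k * (N ^\<^sub>m k) $$ (i, j)"
      using pow_mat_smult[OF N, of t k] carrier_matD[OF Nk] i j by simp
    moreover have "norm ((N ^\<^sub>m k) $$ (i, j)) \<le> b"
      using b[of k] Nk i j N 
      by (auto simp: norm_bound_def of_real_hom.mat_hom_pow[OF N, symmetric])
    ultimately show ?thesis using t0 by (simp add: abs_mult mult.commute)
  qed
  have "(\<lambda>k. b * t ^ k) \<longlonglongrightarrow> 0"
    using t t0 by (intro tendsto_mult_right_zero LIMSEQ_power_zero) auto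
  then show ?thesis
    by (rule tendsto_0_le[where K = 1]) (use bound in \<open>auto intro!: always_eventually order_trans[OF _ abs_ge_self]\<close>)
qed

text \<open>With \<open>M = Q / r\<close> and \<open>y\<close> the column sums of
  \<open>I + M + ... + M^(k-1)\<close>, telescoping gives
  \<open>y^T M = y^T - 1^T + 1^T M^k\<close>. This is at most \<open>y^T\<close> once the column
  sums of \<open>M^k\<close> are below 1.\<close>

lemma exists_subinvariant:
  assumes Q: "Q \<in> carrier_mat n n" and n: "n > 0" and Q0: "0\<^sub>m n n \<le> Q" and r: "rho Q < r"
  obtains y where "y \<in> carrier_vec n" "\<And>j. j < n \<Longrightarrow> 0 < y $ j"
    "\<And>j. j < n \<Longrightarrow> (transpose_mat Q *\<^sub>v y) $ j \<le> r * y $ j"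
proof -
  have r0: "r > 0" using rho_nonneg[OF Q n] r by linarith
  define M where "M = (1 / r) \<cdot>\<^sub>m Q"
  have M: "M \<in> carrier_mat n n" using Q by (simp add: M_def)
  have M0: "0\<^sub>m n n \<le> M" using Q0 r0 by (auto simp: M_def less_eq_mat_def)
  have QM: "Q = r \<cdot>\<^sub>m M" using r0 by (auto simp: M_def intro!: eq_matI)
  have "rho M \<le> 1 / r * rho Q" unfolding M_def by (rule rho_smult_le[OF Q n]) (use r0 in simp)
  also have "\<dots> < 1" using r r0 by simp
  finally have rhoM: "rho M < 1" .
  \<comment> \<open>Column sums of the powers: \<open>s k\<close> is the row vector
    \<open>1^T M^k\<close>.\<close>
  define s where "s k j = (\<Sum>i<n. (M ^\<^sub>m k) $$ (i, j))" for k j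
  have s_nonneg: "s k j \<ge> 0" if "j < n" for k j
    unfolding s_def using nonneg_matD[OF nonneg_pow_mat[OF M M0]] that by (intro sum_nonneg) auto
  have s0: "s 0 j = 1" if "j < n" for j
    using that M by (simp add: s_def)
  have s_Suc: "s (Suc k) j = (\<Sum>i<n. M $$ (i, j) * s k i)" if j: "j < n" for k j
  proof -
    have "s (Suc k) j = (\<Sum>m<n. \<Sum>i<n. (M ^\<^sub>m k) $$ (m, i) * M $$ (i, j))"
      unfolding s_def using j M by (simp add: scalar_prod_def atLeast0LessThan)
    also have "\<dots> = (\<Sum>i<n. \<Sum>m<n. (M ^\<^sub>m k) $$ (m, i) * M $$ (i, j))" by (rule sum.swap)
    finally show ?thesis by (simp add: s_def sum_distrib_left mult.commute)
  qed
  have lim: "(\<lambda>k. s k j) \<longlonglongrightarrow> 0" if "j < n" for j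
    unfolding s_def using pow_mat_tendsto_0[OF M n rhoM] that by (intro tendsto_null_sum) auto
  have "\<forall>\<^sub>F k in sequentially. s k j < 1" if "j < n" for j
    by (rule order_tendstoD(2)[OF lim[OF that]]) simp
  \<comment> \<open>One exponent must serve all columns at once; there are finitely many.\<close>
  then have "\<forall>\<^sub>F k in sequentially. \<forall>j\<in>{..<n}. s k j < 1"
    by (intro eventually_ball_finite) auto
  then obtain k where k: "\<And>j. j < n \<Longrightarrow> s k j < 1"
    by (auto simp: eventually_sequentially)
  \<comment> \<open>Hence the partial sum contains the identity term \<open>s 0 j = 1\<close>, which
    makes \<open>y\<close> positive.\<close>
  have "k \<noteq> 0" using k[of 0] s0[of 0] n by (cases k) auto
  define y where "y = vec n (\<lambda>j. \<Sum>l<k. s l j)"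
  have pos: "0 < y $ j" if j: "j < n" for j
  proof -
    have "0 < (\<Sum>l<k. s l j)"
      by (rule sum_pos2[of _ 0]) (use \<open>k \<noteq> 0\<close> s0 s_nonneg j in auto)
    then show ?thesis using j by (simp add: y_def)
  qed
  have "(transpose_mat Q *\<^sub>v y) $ j \<le> r * y $ j" if j: "j < n" for j
  proof -
    have "(transpose_mat Q *\<^sub>v y) $ j = r * (\<Sum>i<n. M $$ (i, j) * (\<Sum>l<k. s l i))"
      using j M by (simp add: QM scalar_prod_def y_def sum_distrib_left mult.assoc atLeast0LessThan)
    also have "(\<Sum>i<n. M $$ (i, j) * (\<Sum>l<k. s l i)) = (\<Sum>l<k. s (Suc l) j)"
      using j by (simp add: s_Suc sum_distrib_left sum.swap[of _ "{..<n}"])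
    also have "\<dots> = (\<Sum>l<k. s l j) - s 0 j + s k j"
      using sum.lessThan_Suc_shift[of "\<lambda>l. s l j" k] by simp
    also have "\<dots> \<le> y $ j"
      using k[OF j] s0[OF j] j by (simp add: y_def)
    finally show ?thesis using r0 by simp
  qed
  then show ?thesis using that[of y] pos by (auto simp: y_def)
qed


section \<open>Monotone matrices and nonnegative inverses\<close>

lemma monotone_mat_inverse:
  assumes "monotone_mat n A"
  shows "invertible_mat A" and "0\<^sub>m n n \<le> mat_inv A"
proof -
  have A: "A \<in> carrier_mat n n"
    and mono: "\<And>x. x \<in> carrier_vec n \<Longrightarrow> 0\<^sub>v n \<le> A *\<^sub>v x \<Longrightarrow> 0\<^sub>v n \<le> x"
    using assms by (auto simp: monotone_mat_def)
  have "det A \<noteq> 0"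
  proof
    assume "det A = 0"
    then obtain x where x: "x \<in> carrier_vec n" "x \<noteq> 0\<^sub>v n" "A *\<^sub>v x = 0\<^sub>v n"
      using det_0_iff_vec_prod_zero[OF A] by auto
    \<comment> \<open>Monotonicity applies to both signs of a kernel vector, which forces it to be
      zero.\<close>
    have "A *\<^sub>v (- x) = 0\<^sub>v n"
      using x A by (auto simp: vec_eq_iff)
    then have "0\<^sub>v n \<le> x" "0\<^sub>v n \<le> - x" using mono[of x] mono[of "- x"] x by auto
    then have "x = 0\<^sub>v n" using x by (auto simp: less_eq_vec_def vec_eq_iff intro: antisym)
    then show False using x by simp
  qed
  then show inv: "invertible_mat A"
    using det_non_zero_imp_unit[OF A, of "()"] A
    unfolding Units_def ring_mat_def invertible_mat_def inverts_mat_def by auto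
  note Ai = mat_inv[OF A inv]
  show "0\<^sub>m n n \<le> mat_inv A"
    unfolding less_eq_mat_def
  proof (intro conjI allI impI)
    fix i j assume "i < dim_row (mat_inv A)" "j < dim_col (mat_inv A)"
    then have i: "i < n" and j: "j < n" using Ai by auto
    \<comment> \<open>\<open>A\<close> maps column \<open>j\<close> of its inverse to a unit vector,
      which is nonnegative, so monotonicity applies to that column.\<close>
    have "A *\<^sub>v col (mat_inv A) j = col (A * mat_inv A) j"
      by (rule col_mult2[symmetric, OF A Ai(1) j])
    also have "\<dots> = unit_vec n j" using j by (simp add: Ai)
    finally have "0\<^sub>v n \<le> A *\<^sub>v col (mat_inv A) j"
      by (simp add: less_eq_vec_def unit_vec_def)
    then have "0\<^sub>v n \<le> col (mat_inv A) j" using mono Ai j by auto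
    then show "0\<^sub>m n n $$ (i, j) \<le> mat_inv A $$ (i, j)"
      using i j Ai by (auto simp: less_eq_vec_def)
  qed (use Ai in auto)
qed

text \<open>A left-invertible matrix has no zero column: the diagonal entry \<open>(j, j)\<close> of
  \<open>N * M\<close> is 1, so column \<open>j\<close> of \<open>M\<close> has a nonzero, hence
  positive, entry.\<close>

lemma nonneg_left_invertible_col_sum_pos:
  fixes M N :: "real mat"
  assumes M: "M \<in> carrier_mat n n" and N: "N \<in> carrier_mat n n" and M0: "0\<^sub>m n n \<le> M"
    and NM: "N * M = 1\<^sub>m n" and j: "j < n"
  shows "0 < (\<Sum>i<n. M $$ (i, j))"
proof -
  have "(\<Sum>i<n. N $$ (j, i) * M $$ (i, j)) = (N * M) $$ (j, j)"
    using j M N by (simp add: scalar_prod_def atLeast0LessThan)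
  also have "\<dots> \<noteq> 0" using j by (simp add: NM)
  finally obtain i where i: "i < n" "M $$ (i, j) \<noteq> 0"
    by (metis (no_types, lifting) lessThan_iff mult_zero_right sum.neutral)
  show ?thesis
    by (rule sum_pos2[of _ i]) (use i nonneg_matD[OF M0] j in \<open>auto simp: order_less_le\<close>)
qed

section \<open>Algebra of splittings\<close>

lemma splittingD:
  assumes "splitting n A U V"
  shows "A \<in> carrier_mat n n" "U \<in> carrier_mat n n" "V \<in> carrier_mat n n" "A = U - V"
    "mat_inv U \<in> carrier_mat n n" "U * mat_inv U = 1\<^sub>m n" "mat_inv U * U = 1\<^sub>m n"
  using assms mat_inv[of U n] by (auto simp: splitting_def)

lemma splitting_mult_inv:
  assumes "splitting n A U V"
  shows "A * mat_inv U = 1\<^sub>m n - V * mat_inv U"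
proof -
  note s = splittingD[OF assms]
  have "A * mat_inv U = U * mat_inv U - V * mat_inv U"
    using s by (metis minus_mult_distrib_mat)
  then show ?thesis using s by simp
qed

lemma splitting_inv_mult:
  assumes "splitting n A U V"
  shows "mat_inv U * A = 1\<^sub>m n - mat_inv U * V"
proof -
  note s = splittingD[OF assms]
  have "mat_inv U * A = mat_inv U * U - mat_inv U * V"
    using s by (metis mult_minus_distrib_mat)
  then show ?thesis using s by simp
qed

text \<open>Both \<open>A (I - U^-1 V)\<close> and \<open>(I - V U^-1) A\<close> equal
  \<open>A U^-1 A\<close>; subtracting from \<open>A\<close> leaves the claim.\<close>

lemma splitting_intertwines:
  assumes "splitting n A U V"
  shows "A * (mat_inv U * V) = V * mat_inv U * A"
proof -
  note s = splittingD[OF assms]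
  have UV: "mat_inv U * V \<in> carrier_mat n n" and VU: "V * mat_inv U \<in> carrier_mat n n"
    using s by auto
  have "A - A * (mat_inv U * V) = A * (1\<^sub>m n - mat_inv U * V)"
    using mult_minus_distrib_mat[OF s(1) one_carrier_mat UV] s(1) by simp
  also have "\<dots> = (1\<^sub>m n - V * mat_inv U) * A"
    unfolding splitting_inv_mult[OF assms, symmetric] splitting_mult_inv[OF assms, symmetric]
    using s(1,5) by (simp add: assoc_mult_mat)
  also have "\<dots> = A - V * mat_inv U * A"
    using minus_mult_distrib_mat[OF one_carrier_mat VU s(1)] s(1) by simp
  finally have eq: "A - A * (mat_inv U * V) = A - V * mat_inv U * A" .
  have c: "A * (mat_inv U * V) \<in> carrier_mat n n" "V * mat_inv U * A \<in> carrier_mat n n"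
    using s(1) UV VU by auto
  show ?thesis
  proof (rule eq_matI)
    fix i j assume "i < dim_row (V * mat_inv U * A)" "j < dim_col (V * mat_inv U * A)"
    then show "(A * (mat_inv U * V)) $$ (i, j) = (V * mat_inv U * A) $$ (i, j)"
      using arg_cong[OF eq, of "\<lambda>M. M $$ (i, j)"] carrier_matD[OF c(1)] carrier_matD[OF c(2)]
        carrier_matD[OF s(1)]
      by (simp del: index_mult_mat)
  qed (use c[THEN carrier_matD(1)] c[THEN carrier_matD(2)] in \<open>simp_all del: index_mult_mat\<close>)
qed

section \<open>Convergence and comparison of weak regular splittings\<close>

lemma transpose_mult_mat_vec:
  fixes M N :: "real mat"
  assumes "M \<in> carrier_mat n n" and "N \<in> carrier_mat n n" and "y \<in> carrier_vec n"
  shows "transpose_mat (M * N) *\<^sub>v y = transpose_mat N *\<^sub>v (transpose_mat M *\<^sub>v y)"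
  using assms transpose_mult[of M n n N n] by simp

text \<open>Besides giving the final strict bound, this makes the interval
  \<open>rho Q < r < 1\<close> in the comparison of two splittings nonempty.\<close>

lemma rho_weak_regular_less_1:
  assumes n: "n > 0" and A: "monotone_mat n A" and UV: "weak_regular_type_II n A U V"
  shows "rho (V * mat_inv U) < 1"
proof -
  have sp: "splitting n A U V" and U0: "0\<^sub>m n n \<le> mat_inv U" and P0: "0\<^sub>m n n \<le> V * mat_inv U"
    using UV by (auto simp: weak_regular_type_II_def)
  note s = splittingD[OF sp]
  note A' = monotone_mat_inverse[OF A]
  note Ai = mat_inv[OF s(1) A'(1)]
  let ?P = "V * mat_inv U" and ?e = "vec n (\<lambda>_. 1) :: real vec"
  have P: "?P \<in> carrier_mat n n" using s by auto
  have "mat_inv U = mat_inv A * (A * mat_inv U)"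
    using Ai s(1,5) by (simp flip: assoc_mult_mat[of _ n n _ n _ n])
  also have "\<dots> = mat_inv A - mat_inv A * ?P"
    unfolding splitting_mult_inv[OF sp]
    using mult_minus_distrib_mat[OF Ai(1) one_carrier_mat P] Ai by simp
  finally have U: "mat_inv U = mat_inv A - mat_inv A * ?P" .
  \<comment> \<open>The row vector \<open>1^T A^-1\<close>. By the formula for
    \<open>mat_inv U\<close>, \<open>y^T - y^T P\<close> is \<open>1^T U^-1\<close>, the column sums
    of a nonnegative invertible matrix.\<close>
  define y where "y = transpose_mat (mat_inv A) *\<^sub>v ?e"
  have y: "y \<in> carrier_vec n" using Ai by (simp add: y_def)
  have y_eq: "y $ j = (\<Sum>i<n. mat_inv A $$ (i, j))" if "j < n" for j
    using that Ai by (simp add: y_def scalar_prod_def atLeast0LessThan)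
  have Py: "transpose_mat ?P *\<^sub>v y = transpose_mat (mat_inv A * ?P) *\<^sub>v ?e"
    unfolding y_def by (rule transpose_mult_mat_vec[symmetric, OF Ai(1) P]) simp
  have Py_eq: "(transpose_mat ?P *\<^sub>v y) $ j = (\<Sum>i<n. (mat_inv A * ?P) $$ (i, j))" if "j < n" for j
    unfolding Py using that carrier_matD[OF mult_carrier_mat[OF Ai(1) P]]
    by (simp add: scalar_prod_def[of _ ?e] atLeast0LessThan del: index_mult_mat)
  show ?thesis
  proof (rule rho_less_1_subinvariant[OF P n P0 y])
    fix j assume j: "j < n"
    show "0 < y $ j"
      unfolding y_eq[OF j] by (rule nonneg_left_invertible_col_sum_pos[OF Ai(1) s(1) A'(2) Ai(2) j])
    have "0 < (\<Sum>i<n. mat_inv U $$ (i, j))"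
      by (rule nonneg_left_invertible_col_sum_pos[OF s(5,2) U0 s(6) j])
    also have "\<dots> = (\<Sum>i<n. mat_inv A $$ (i, j) - (mat_inv A * ?P) $$ (i, j))"
      by (subst U) (use j Ai s in \<open>simp del: index_mult_mat(1)\<close>)
    also have "\<dots> = y $ j - (transpose_mat ?P *\<^sub>v y) $ j"
      using j by (simp add: y_eq Py_eq sum_subtractf del: index_mult_mat(1))
    finally show "(transpose_mat ?P *\<^sub>v y) $ j < y $ j" by simp
  qed
qed

text \<open>With \<open>D = U B^-1\<close> one has \<open>I - S = (I - Q) D\<close>. A test vector
  \<open>y\<close> for \<open>Q\<close> gives \<open>z^T = y^T (I - Q)\<close>, and
  \<open>D \<ge> I\<close> yields \<open>y^T (I - S) = z^T D \<ge> z^T \<ge> (1 - r) y^T\<close>, so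
  \<open>y\<close> is a test vector for \<open>S\<close> with the same \<open>r\<close>.\<close>

lemma rho_weak_regular_mono:
  assumes n: "n > 0" and A: "monotone_mat n A"
    and BC: "weak_regular_type_II n A B C" and UV: "weak_regular_type_II n A U V"
    and UB: "1\<^sub>m n \<le> U * mat_inv B"
  shows "rho (C * mat_inv B) \<le> rho (V * mat_inv U)"
proof -
  have b: "splitting n A B C" and S0: "0\<^sub>m n n \<le> C * mat_inv B"
    using BC by (auto simp: weak_regular_type_II_def)
  have u: "splitting n A U V" and Q0: "0\<^sub>m n n \<le> V * mat_inv U"
    using UV by (auto simp: weak_regular_type_II_def)
  note sb = splittingD[OF b] and su = splittingD[OF u]
  let ?S = "C * mat_inv B" and ?Q = "V * mat_inv U" and ?D = "U * mat_inv B"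
  have S: "?S \<in> carrier_mat n n" and Q: "?Q \<in> carrier_mat n n" and D: "?D \<in> carrier_mat n n"
    using sb su by auto
  have "(1\<^sub>m n - ?Q) * ?D = A * (mat_inv U * U) * mat_inv B"
    unfolding splitting_mult_inv[OF u, symmetric]
    using su(1,2,5) sb(5) by (simp add: assoc_mult_mat[of _ n n _ n _ n] del: su(7))
  also have "\<dots> = 1\<^sub>m n - ?S"
    using splitting_mult_inv[OF b] su by simp
  finally have factor: "(1\<^sub>m n - ?Q) * ?D = 1\<^sub>m n - ?S" .
  have "rho ?S \<le> r" if r: "rho ?Q < r" "r < 1" for r
  proof -
    obtain y where y: "y \<in> carrier_vec n" "\<And>j. j < n \<Longrightarrow> 0 < y $ j"
      and Qy: "\<And>j. j < n \<Longrightarrow> (transpose_mat ?Q *\<^sub>v y) $ j \<le> r * y $ j"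
      by (rule exists_subinvariant[OF Q n Q0 r(1)]) blast
    define z where "z = transpose_mat (1\<^sub>m n - ?Q) *\<^sub>v y"
    have z: "z \<in> carrier_vec n" unfolding z_def
      using Q y(1) by (intro mult_mat_vec_carrier[of _ n n]) (auto intro: minus_carrier_mat)
    have sub: "(transpose_mat (1\<^sub>m n - M) *\<^sub>v y) $ j = y $ j - (transpose_mat M *\<^sub>v y) $ j"
      if "M \<in> carrier_mat n n" "j < n" for M j
      using that y
      by (simp add: transpose_minus[of _ n n] minus_mult_distrib_mat_vec[of _ n n] del: index_mult_mat_vec)
    have z_ge: "(1 - r) * y $ j \<le> z $ j" if "j < n" for j
      using sub[OF Q that] Qy[OF that] by (simp add: z_def algebra_simps)
    \<comment> \<open>Here \<open>r < 1\<close> enters: multiplying \<open>I \<le> D\<close> by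
      \<open>z\<close> preserves the inequality because \<open>z\<close> is nonnegative.\<close>
    have z0: "0 \<le> z $ j" if "j < n" for j
      using z_ge[OF that] y(2)[OF that] r by (smt (verit) mult_nonneg_nonneg)
    show ?thesis
    proof (rule rho_le_subinvariant[OF S n S0 y])
      fix j assume j: "j < n"
      have "z $ j = (\<Sum>i<n. 1\<^sub>m n $$ (i, j) * z $ i)"
        using j by (simp add: if_distrib[of "\<lambda>x. x * _"] cong: if_cong)
      also have "\<dots> \<le> (\<Sum>i<n. ?D $$ (i, j) * z $ i)"
        using UB z0 j carrier_matD[OF D]
        by (intro sum_mono mult_right_mono) (auto simp: less_eq_mat_def simp del: index_mult_mat index_one_mat(1))
      also have "\<dots> = (transpose_mat ?D *\<^sub>v z) $ j"
        using j carrier_matD[OF D] z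
        by (simp add: scalar_prod_def[of _ z] atLeast0LessThan del: index_mult_mat)
      also have "transpose_mat ?D *\<^sub>v z = transpose_mat (1\<^sub>m n - ?S) *\<^sub>v y"
        unfolding z_def factor[symmetric] using Q D y
        by (intro transpose_mult_mat_vec[symmetric]) (auto intro: minus_carrier_mat)
      also have "\<dots> $ j = y $ j - (transpose_mat ?S *\<^sub>v y) $ j"
        by (rule sub[OF S j])
      finally show "(transpose_mat ?S *\<^sub>v y) $ j \<le> r * y $ j"
        using z_ge[OF j] by (simp add: algebra_simps)
    qed
  qed
  \<comment> \<open>Let \<open>r\<close> decrease to \<open>rho Q\<close> inside the interval up to
    1.\<close>
  then show ?thesis
    by (rule dense_ge_bounded[OF rho_weak_regular_less_1[OF n A UV]])
qed

section \<open>Similarity of \<open>H\<close> and \<open>S\<close>, and the comparison with the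
  two-factor products\<close>

lemma rho_eq_of_intertwining:
  assumes A: "A \<in> carrier_mat n n" and inv: "invertible_mat A" and n: "n > 0"
    and H: "H \<in> carrier_mat n n" and S: "S \<in> carrier_mat n n" and AH: "A * H = S * A"
  shows "rho H = rho S"
proof -
  note Ai = mat_inv[OF A inv]
  have SA: "S * A \<in> carrier_mat n n" using S A by auto
  \<comment> \<open>Similarity through \<open>A\<close>; commuting the two factors under
    \<open>rho\<close> then removes the conjugation.\<close>
  have "H = mat_inv A * (S * A)"
    using Ai A H by (simp flip: AH assoc_mult_mat[of _ n n _ n _ n])
  also have "rho \<dots> = rho (S * A * mat_inv A)" by (rule rho_mult_commute[OF Ai(1) SA n])
  also have "S * A * mat_inv A = S"
    using Ai A S by (simp add: assoc_mult_mat[of _ n n _ n _ n])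
  finally show ?thesis .
qed

theorem corollary3p20:
  fixes n :: nat
    and A K L U V X Y B C B12 C12 B13 C13 B23 C23 H S :: "real mat"
  assumes "n \<ge> 1"
    and "monotone_mat n A"
    and "weak_regular_type_II n A K L"
    and "weak_regular_type_II n A U V"
    and "weak_regular_type_II n A X Y"
    and "H = mat_inv X * Y * mat_inv U * V * mat_inv K * L"
    and "S = Y * mat_inv X * V * mat_inv U * L * mat_inv K"
    and "weak_regular_type_II n A B C" and "induced_right n A B C S"
    and "weak_regular_type_II n A B12 C12"
    and "induced_iteration n A B12 C12 (mat_inv U * V * mat_inv K * L)"
    and "weak_regular_type_II n A B13 C13"
    and "induced_iteration n A B13 C13 (mat_inv X * Y * mat_inv K * L)"
    and "weak_regular_type_II n A B23 C23"
    and "induced_iteration n A B23 C23 (mat_inv X * Y * mat_inv U * V)"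
    and "1\<^sub>m n \<le> B12 * mat_inv B"
    and "1\<^sub>m n \<le> B13 * mat_inv B"
    and "1\<^sub>m n \<le> B23 * mat_inv B"
  shows "rho H \<le> Min {rho (mat_inv K * L * mat_inv U * V),
                       rho (mat_inv X * Y * mat_inv K * L),
                       rho (mat_inv X * Y * mat_inv U * V)}
       \<and> Min {rho (mat_inv K * L * mat_inv U * V),
              rho (mat_inv X * Y * mat_inv K * L),
              rho (mat_inv X * Y * mat_inv U * V)} < 1"
proof -
  have n: "n > 0" using assms(1) by simp
  have sK: "splitting n A K L" and sU: "splitting n A U V" and sX: "splitting n A X Y"
    using assms(3-5) by (auto simp: weak_regular_type_II_def)
  note dK = splittingD[OF sK] and dU = splittingD[OF sU] and dX = splittingD[OF sX]
  note assoc = assoc_mult_mat[of _ n n _ n _ n]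
  \<comment> \<open>Each \<open>T\<close> is an iteration matrix and each \<open>P\<close> its
    counterpart with the inverse on the right; passing \<open>A\<close> from left to right turns
    every \<open>T\<close> into the corresponding \<open>P\<close>.\<close>
  define TK TU TX PK PU PX where
    T: "TK = mat_inv K * L" "TU = mat_inv U * V" "TX = mat_inv X * Y"
      "PK = L * mat_inv K" "PU = V * mat_inv U" "PX = Y * mat_inv X"
  have Tc: "TK \<in> carrier_mat n n" "TU \<in> carrier_mat n n" "TX \<in> carrier_mat n n"
    "PK \<in> carrier_mat n n" "PU \<in> carrier_mat n n" "PX \<in> carrier_mat n n"
    using dK dU dX by (auto simp: T)
  have H: "H = TX * (TU * TK)" and S: "S = PX * (PU * PK)"
    unfolding assms(6,7) T using dK(3,5) dU(3,5) dX(3,5) by (simp_all add: assoc)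
  have pairs: "mat_inv K * L * mat_inv U * V = TK * TU" "mat_inv U * V * mat_inv K * L = TU * TK"
    "mat_inv X * Y * mat_inv K * L = TX * TK" "mat_inv X * Y * mat_inv U * V = TX * TU"
    unfolding T using dK(3,5) dU(3,5) dX(3,5) by (simp_all add: assoc)
  have inter: "A * TK = PK * A" "A * TU = PU * A" "A * TX = PX * A"
    unfolding T by (rule splitting_intertwines[OF sK] splitting_intertwines[OF sU] splitting_intertwines[OF sX])+
  have "A * H = (A * TX) * (TU * TK)" using Tc dK(1) by (simp add: H assoc)
  also have "\<dots> = PX * ((A * TU) * TK)" using Tc dK(1) by (simp add: inter(3) assoc)
  also have "\<dots> = PX * (PU * (A * TK))" using Tc dK(1) by (simp add: inter(2) assoc)
  also have "\<dots> = S * A" using Tc dK(1) by (simp add: inter(1) S assoc)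
  finally have "A * H = S * A" .
  moreover have "H \<in> carrier_mat n n" "S \<in> carrier_mat n n" using Tc by (auto simp: H S)
  ultimately have "rho H = rho S"
    using rho_eq_of_intertwining[OF dK(1) monotone_mat_inverse(1)[OF assms(2)] n] by blast
  also have "S = C * mat_inv B" using assms(9) by (simp add: induced_right_def)
  finally have rho_H: "rho H = rho (C * mat_inv B)" .
  have pair: "rho H \<le> rho T \<and> rho T < 1"
    if "weak_regular_type_II n A B' C'" "induced_iteration n A B' C' T" "1\<^sub>m n \<le> B' * mat_inv B"
    for B' C' T
  proof -
    have s: "splitting n A B' C'" and T: "T = mat_inv B' * C'"
      using that(2) by (auto simp: induced_iteration_def)
    \<comment> \<open>The induced splitting is given through \<open>B'^-1 C'\<close>, while
      nonnegativity is known for \<open>C' B'^-1\<close>; commuting the factors bridges the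
      two.\<close>
    have "rho T = rho (C' * mat_inv B')"
      unfolding T using splittingD[OF s] n by (intro rho_mult_commute) auto
    then show ?thesis
      using rho_H rho_weak_regular_mono[OF n assms(2,8) that(1,3)]
        rho_weak_regular_less_1[OF n assms(2) that(1)] by simp
  qed
  \<comment> \<open>The first entry of the minimum has its factors in the order opposite to the
    matrix inducing \<open>B12\<close>.\<close>
  have "rho (TK * TU) = rho (TU * TK)" using Tc n by (intro rho_mult_commute) auto
  then show ?thesis
    using pair[OF assms(10,11,16)] pair[OF assms(12,13,17)] pair[OF assms(14,15,18)]
    by (simp add: pairs min_less_iff_disj)
qed

end
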